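(* Let $\lambda>0$, let $\chi$ be the Poisson$(\lambda)$ distribution, and let $(p,q)\in[0,1]^2$ with $0<p+q<1$. The probability that the bond percolation game with parameter-pair $(p,q)$, played on the rooted Galton-Watson tree $T_\chi$ starting from its root, results in a draw is $0$ if and only if $$(1-p-q)\,\lambda\, e^{-\lambda q}\le e.$$
   Context: $T_\chi$ is the rooted Galton-Watson tree with root $\phi$ in which the numbers of children of the vertices are i.i.d. with law $\chi$. Each edge $\{u,v\}$ ($u$ the parent of $v$) is directed from $u$ to $v$. Bond percolation game with parameter-pair $(p,q)$: given $T_\chi$, each edge is independently labeled trap with probability $p$, target with probability $q$, safe with probability $1-p-q$. The tree and all labels are revealed to both players (perfect information). Two players alternately move a token, initially at $\phi$; a move takes the token from its current vertex $u$ along a directed edge to a child of $u$. A player who moves the token along a target edge wins immediately; a player who moves it along a trap edge loses immediately; a player whose turn it is to move when the token is at a leaf (childless vertex) loses. If the game continues forever it is a draw. Both players play optimally: for a given realization, the game is won (respectively lost) by the first player if the first (respectively second) player has a strategy guaranteeing a win for herself in finitely many rounds against any play of the opponent; otherwise the game results in a draw. *)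

theory Defs
  imports "HOL-Probability.Probability"
begin

datatype edge_label = Trap | Target | Safe

text \<open>
  A vertex of a rooted plane tree is its Ulam--Harris address: \<open>[]\<close> is the root and
  \<open>v @ [i]\<close> is the \<open>i\<close>-th child of \<open>v\<close>, counted from 0. A realization \<open>\<omega>\<close> assigns to every
  address the number of its children together with the label of the edge that joins it to its
  parent. The label at the root and the data at addresses outside the tree have no meaning
  and do not affect the game.
\<close>

type_synonym vertex = "nat list"
type_synonym realization = "vertex \<Rightarrow> nat \<times> edge_label"

definition num_children :: "realization \<Rightarrow> vertex \<Rightarrow> nat" where
  "num_children \<omega> v = fst (\<omega> v)"

definition edge_label_into :: "realization \<Rightarrow> vertex \<Rightarrow> edge_label" where
  "edge_label_into \<omega> v = snd (\<omega> v)"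

definition tree_vertices :: "realization \<Rightarrow> vertex set" where
  "tree_vertices \<omega> = {v. \<forall>k<length v. v ! k < num_children \<omega> (take k v)}"

definition label_pmf :: "real \<Rightarrow> real \<Rightarrow> edge_label pmf" where
  "label_pmf p q =
     embed_pmf (\<lambda>l. case l of Trap \<Rightarrow> p | Target \<Rightarrow> q | Safe \<Rightarrow> 1 - p - q)"

lemma pmf_label_pmf:
  assumes "0 \<le> p" "0 \<le> q" "p + q \<le> 1"
  shows "pmf (label_pmf p q) l = (case l of Trap \<Rightarrow> p | Target \<Rightarrow> q | Safe \<Rightarrow> 1 - p - q)"
proof -
  have UNIV_eq: "(UNIV :: edge_label set) = {Trap, Target, Safe}"
    using edge_label.exhaust by auto
  then have fin: "finite (UNIV :: edge_label set)"
    by (metis finite.emptyI finite.insertI)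
  show ?thesis
    unfolding label_pmf_def
  proof (rule pmf_embed_pmf)
    show "0 \<le> (case l of Trap \<Rightarrow> p | Target \<Rightarrow> q | Safe \<Rightarrow> 1 - p - q)" for l
      using assms by (cases l) auto
    have "(\<integral>\<^sup>+l. ennreal (case l of Trap \<Rightarrow> p | Target \<Rightarrow> q | Safe \<Rightarrow> 1 - p - q)
             \<partial>count_space UNIV) = ennreal p + (ennreal q + ennreal (1 - p - q))"
      using fin by (simp add: nn_integral_count_space_finite UNIV_eq)
    also have "\<dots> = 1"
      using assms by (simp flip: ennreal_plus)
    finally show "(\<integral>\<^sup>+l. ennreal (case l of Trap \<Rightarrow> p | Target \<Rightarrow> q | Safe \<Rightarrow> 1 - p - q)
             \<partial>count_space UNIV) = 1" .
  qed
qed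

text \<open>
  The Galton--Watson tree with offspring law \<open>offspring\<close> and its edge labels: all child counts and all
  labels, over all addresses, are independent.
\<close>

definition labeled_GW :: "nat pmf \<Rightarrow> real \<Rightarrow> real \<Rightarrow> realization measure" where
  "labeled_GW offspring p q = PiM UNIV (\<lambda>v. measure_pmf (pair_pmf offspring (label_pmf p q)))"

datatype player = First | Second

text \<open>The token moves one level down in every round, so the depth of a vertex decides whose
  turn it is there.\<close>

definition turn :: "vertex \<Rightarrow> player" where
  "turn v = (if even (length v) then First else Second)"

text \<open>
  A strategy picks the index of the child to move to. Since a vertex determines the path that
  leads to it, a function of the current vertex already encodes full dependence on the past.
\<close>

type_synonym strategy = "vertex \<Rightarrow> nat"

definition legal_strategy :: "realization \<Rightarrow> player \<Rightarrow> strategy \<Rightarrow> bool" where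
  "legal_strategy \<omega> P \<sigma> \<longleftrightarrow>
     (\<forall>v\<in>tree_vertices \<omega>. turn v = P \<and> num_children \<omega> v \<noteq> 0 \<longrightarrow> \<sigma> v < num_children \<omega> v)"

text \<open>
  The position of the token after \<open>n\<close> moves, when \<open>First\<close> follows \<open>\<sigma>\<close> and \<open>Second\<close> follows
  \<open>\<tau>\<close>. The sequence continues formally after the game has been decided; those positions are
  ignored below.
\<close>

primrec token :: "strategy \<Rightarrow> strategy \<Rightarrow> nat \<Rightarrow> vertex" where
  "token \<sigma> \<tau> 0 = []"
| "token \<sigma> \<tau> (Suc n) =
     token \<sigma> \<tau> n @ [case turn (token \<sigma> \<tau> n) of First \<Rightarrow> \<sigma> (token \<sigma> \<tau> n)
                                             | Second \<Rightarrow> \<tau> (token \<sigma> \<tau> n)]"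

definition undecided_until :: "realization \<Rightarrow> (nat \<Rightarrow> vertex) \<Rightarrow> nat \<Rightarrow> bool" where
  "undecided_until \<omega> x n \<longleftrightarrow>
     (\<forall>k<n. num_children \<omega> (x k) \<noteq> 0 \<and> edge_label_into \<omega> (x (Suc k)) = Safe)"

definition play_won_by :: "realization \<Rightarrow> player \<Rightarrow> (nat \<Rightarrow> vertex) \<Rightarrow> bool" where
  "play_won_by \<omega> P x \<longleftrightarrow>
     (\<exists>n. undecided_until \<omega> x n \<and>
          (if num_children \<omega> (x n) = 0 then turn (x n) \<noteq> P
           else (turn (x n) = P \<and> edge_label_into \<omega> (x (Suc n)) = Target) \<or>
                (turn (x n) \<noteq> P \<and> edge_label_into \<omega> (x (Suc n)) = Trap)))"

definition game_won :: "realization \<Rightarrow> bool" where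
  "game_won \<omega> \<longleftrightarrow>
     (\<exists>\<sigma>. legal_strategy \<omega> First \<sigma> \<and>
          (\<forall>\<tau>. legal_strategy \<omega> Second \<tau> \<longrightarrow> play_won_by \<omega> First (token \<sigma> \<tau>)))"

definition game_lost :: "realization \<Rightarrow> bool" where
  "game_lost \<omega> \<longleftrightarrow>
     (\<exists>\<tau>. legal_strategy \<omega> Second \<tau> \<and>
          (\<forall>\<sigma>. legal_strategy \<omega> First \<sigma> \<longrightarrow> play_won_by \<omega> Second (token \<sigma> \<tau>)))"

definition game_drawn :: "realization \<Rightarrow> bool" where
  "game_drawn \<omega> \<longleftrightarrow> \<not> game_won \<omega> \<and> \<not> game_lost \<omega>"

end

theory Submission
  imports Defs
begin

text \<open>
  Let \<open>v\<^sub>n\<close> be the probability that the first player cannot force a win within \<open>n\<close> moves and \<open>l\<^sub>n\<close> the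
  probability that she loses within \<open>n\<close> moves. Poisson thinning gives \<open>v\<^sub>0 = 1\<close>, \<open>l\<^sub>0 = 0\<close>,
  \<open>v\<^sub>n\<^sub>+\<^sub>1 = g l\<^sub>n\<close> and \<open>l\<^sub>n\<^sub>+\<^sub>1 = g v\<^sub>n\<close> with \<open>g x = exp (- lam (q + (1 - p - q) x))\<close>, and since the tree branches
  finitely the probability of a draw is \<open>lim v\<^sub>n - lim l\<^sub>n\<close>. In the variable
  \<open>y = lam (1 - p - q) x\<close> the map \<open>g\<close> becomes \<open>h y = B exp (- y)\<close> with \<open>B = (1 - p - q) lam exp (- lam q)\<close>. Its second iterate
  has the derivative \<open>B u exp (- u) \<le> B / e\<close> at \<open>y\<close>, where \<open>u = h y\<close>; so for \<open>B \<le> e\<close> there is no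
  2-cycle and the limits agree. For \<open>B > e\<close> the fixed point of \<open>h\<close> exceeds 1 and is repelling,
  so the increasing sequence \<open>l\<^sub>n\<close> cannot converge to it.
\<close>

section \<open>Optimal play\<close>

text \<open>Backward induction over a bounded number of rounds, always from the view of the player
  to move at \<open>v\<close>, so that \<open>turn\<close> does not occur. At a leaf the universal
  quantifier is vacuous: \<open>loses_in 1\<close> holds there and \<open>wins_in\<close> never
  does, which encodes that a stuck player loses.\<close>

fun wins_in :: "nat \<Rightarrow> realization \<Rightarrow> vertex \<Rightarrow> bool"
  and loses_in :: "nat \<Rightarrow> realization \<Rightarrow> vertex \<Rightarrow> bool" where
  "wins_in 0 \<omega> v = False"
| "loses_in 0 \<omega> v = False"
| "wins_in (Suc n) \<omega> v = (\<exists>i<num_children \<omega> v. edge_label_into \<omega> (v @ [i]) = Target \<or>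
     edge_label_into \<omega> (v @ [i]) = Safe \<and> loses_in n \<omega> (v @ [i]))"
| "loses_in (Suc n) \<omega> v = (\<forall>i<num_children \<omega> v. edge_label_into \<omega> (v @ [i]) = Trap \<or>
     edge_label_into \<omega> (v @ [i]) = Safe \<and> wins_in n \<omega> (v @ [i]))"

lemma wins_in_loses_in_Suc:
  "(wins_in n \<omega> v \<longrightarrow> wins_in (Suc n) \<omega> v) \<and> (loses_in n \<omega> v \<longrightarrow> loses_in (Suc n) \<omega> v)"
proof (induction n arbitrary: v)
  case (Suc n)
  then show ?case
    unfolding wins_in.simps(2)[of n] wins_in.simps(2)[of "Suc n"]
      loses_in.simps(2)[of n] loses_in.simps(2)[of "Suc n"] by blast
qed simp

lemma wins_in_mono: "wins_in m \<omega> v \<Longrightarrow> m \<le> n \<Longrightarrow> wins_in n \<omega> v"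
  and loses_in_mono: "loses_in m \<omega> v \<Longrightarrow> m \<le> n \<Longrightarrow> loses_in n \<omega> v"
  using lift_Suc_mono_le[of "\<lambda>n. wins_in n \<omega> v"] lift_Suc_mono_le[of "\<lambda>n. loses_in n \<omega> v"]
    wins_in_loses_in_Suc by (auto simp: le_bool_def)

lemma not_wins_in_and_loses_in: "\<not> (wins_in n \<omega> v \<and> loses_in n \<omega> v)"
  by (induction n arbitrary: v) auto

text \<open>Play from a vertex consults only addresses that extend it, so the game at child
  \<open>i\<close> is the root game of the realization seen from that child. This carries the
  recursion over to independent copies of the tree.\<close>

lemma wins_in_shift:
  "wins_in n (\<lambda>u. \<omega> (i # u)) v = wins_in n \<omega> (i # v) \<and>
   loses_in n (\<lambda>u. \<omega> (i # u)) v = loses_in n \<omega> (i # v)"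
  by (induction n arbitrary: v) (simp_all add: num_children_def edge_label_into_def)

definition wins :: "realization \<Rightarrow> vertex \<Rightarrow> bool" where
  "wins \<omega> v \<longleftrightarrow> (\<exists>n. wins_in n \<omega> v)"

definition loses :: "realization \<Rightarrow> vertex \<Rightarrow> bool" where
  "loses \<omega> v \<longleftrightarrow> (\<exists>n. loses_in n \<omega> v)"

lemma winsI: "i < num_children \<omega> v \<Longrightarrow> edge_label_into \<omega> (v @ [i]) = Target \<or>
     edge_label_into \<omega> (v @ [i]) = Safe \<and> loses \<omega> (v @ [i]) \<Longrightarrow> wins \<omega> v"
  unfolding wins_def loses_def by (metis wins_in.simps(2))

text \<open>Finite branching makes the bounds on the duration of the children's games uniform.\<close>

lemma losesI:
  assumes "\<And>i. i < num_children \<omega> v \<Longrightarrow> edge_label_into \<omega> (v @ [i]) = Trap \<or>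
     edge_label_into \<omega> (v @ [i]) = Safe \<and> wins \<omega> (v @ [i])"
  shows "loses \<omega> v"
proof -
  have "\<exists>n. i < num_children \<omega> v \<longrightarrow> edge_label_into \<omega> (v @ [i]) = Trap \<or>
     edge_label_into \<omega> (v @ [i]) = Safe \<and> wins_in n \<omega> (v @ [i])" for i
    using assms unfolding wins_def by blast
  then obtain n where n: "\<And>i. i < num_children \<omega> v \<Longrightarrow> edge_label_into \<omega> (v @ [i]) = Trap \<or>
     edge_label_into \<omega> (v @ [i]) = Safe \<and> wins_in (n i) \<omega> (v @ [i])"
    by metis
  define m where "m = Max (n ` {..<num_children \<omega> v})"
  have "n i \<le> m" if "i < num_children \<omega> v" for i
    using that by (simp add: m_def)
  with n have "loses_in (Suc m) \<omega> v"
    unfolding loses_in.simps using wins_in_mono by blast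
  then show ?thesis
    unfolding loses_def by blast
qed

text \<open>The condition for all \<open>n\<close> asks for a fastest win, which guarantees progress.\<close>

definition good_move :: "realization \<Rightarrow> vertex \<Rightarrow> nat \<Rightarrow> bool" where
  "good_move \<omega> v i \<longleftrightarrow> i < num_children \<omega> v \<and>
     (\<forall>n. wins_in (Suc n) \<omega> v \<longrightarrow> edge_label_into \<omega> (v @ [i]) = Target \<or>
        edge_label_into \<omega> (v @ [i]) = Safe \<and> loses_in n \<omega> (v @ [i])) \<and>
     (\<not> loses \<omega> v \<longrightarrow> edge_label_into \<omega> (v @ [i]) = Target \<or>
        edge_label_into \<omega> (v @ [i]) = Safe \<and> \<not> wins \<omega> (v @ [i]))"

lemma not_wins_and_loses: "\<not> (wins \<omega> v \<and> loses \<omega> v)"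
  unfolding wins_def loses_def
  by (metis nat_le_linear not_wins_in_and_loses_in wins_in_mono loses_in_mono)

lemma good_move_exists:
  assumes "num_children \<omega> v \<noteq> 0"
  shows "\<exists>i. good_move \<omega> v i"
proof (cases "wins \<omega> v")
  case True
  define n where "n = (LEAST n. wins_in n \<omega> v)"
  have "wins_in n \<omega> v"
    using True LeastI_ex[of "\<lambda>n. wins_in n \<omega> v"] unfolding wins_def n_def by blast
  then obtain m where m: "n = Suc m"
    by (cases n) auto
  have least: "m \<le> k" if "wins_in (Suc k) \<omega> v" for k
    using Least_le[of "\<lambda>n. wins_in n \<omega> v", OF that] m by (simp add: n_def)
  obtain i where i: "i < num_children \<omega> v" and "edge_label_into \<omega> (v @ [i]) = Target \<or>
     edge_label_into \<omega> (v @ [i]) = Safe \<and> loses_in m \<omega> (v @ [i])"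
    using \<open>wins_in n \<omega> v\<close> unfolding m by auto
  moreover from this have "edge_label_into \<omega> (v @ [i]) = Target \<or>
     edge_label_into \<omega> (v @ [i]) = Safe \<and> \<not> wins \<omega> (v @ [i])"
    using not_wins_and_loses loses_def by blast
  ultimately have "good_move \<omega> v i"
    unfolding good_move_def using least loses_in_mono by blast
  then show ?thesis ..
next
  case False
  then have nw: "\<not> wins_in n \<omega> v" for n
    unfolding wins_def by blast
  show ?thesis
  proof (cases "loses \<omega> v")
    case True
    then have "good_move \<omega> v 0"
      using nw assms unfolding good_move_def by blast
    then show ?thesis ..
  next
    case False
    then obtain i where "i < num_children \<omega> v" "edge_label_into \<omega> (v @ [i]) \<noteq> Trap"
      "\<not> (edge_label_into \<omega> (v @ [i]) = Safe \<and> wins \<omega> (v @ [i]))"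
      using losesI[of \<omega> v] by blast
    then have "good_move \<omega> v i"
      unfolding good_move_def using nw edge_label.exhaust by metis
    then show ?thesis ..
  qed
qed

section \<open>The strategy of fastest wins and the plays that follow it\<close>

definition best :: "realization \<Rightarrow> strategy" where
  "best \<omega> v = (SOME i. good_move \<omega> v i)"

lemma best: "num_children \<omega> v \<noteq> 0 \<Longrightarrow> good_move \<omega> v (best \<omega> v)"
  unfolding best_def using good_move_exists by (rule someI_ex)

lemma legal_best: "legal_strategy \<omega> P (best \<omega>)"
  unfolding legal_strategy_def using best good_move_def by blast

fun other :: "player \<Rightarrow> player" where
  "other First = Second"
| "other Second = First"

text \<open>Records only what matters about a play in which \<open>P\<close> follows
  \<open>best\<close>, so that both players are handled together. A move is required to lead to an
  existing child only while the play is undecided, because legality constrains a strategy only on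
  the tree.\<close>

definition best_play :: "realization \<Rightarrow> player \<Rightarrow> (nat \<Rightarrow> vertex) \<Rightarrow> bool" where
  "best_play \<omega> P x \<longleftrightarrow> x 0 = [] \<and> (\<forall>n. \<exists>i. x (Suc n) = x n @ [i] \<and>
     (turn (x n) = P \<longrightarrow> i = best \<omega> (x n)) \<and>
     (undecided_until \<omega> x n \<and> num_children \<omega> (x n) \<noteq> 0 \<longrightarrow> i < num_children \<omega> (x n)))"

lemma tree_vertices_snoc:
  "v \<in> tree_vertices \<omega> \<Longrightarrow> i < num_children \<omega> v \<Longrightarrow> v @ [i] \<in> tree_vertices \<omega>"
  unfolding tree_vertices_def by (auto simp: nth_append less_Suc_eq)

text \<open>An undecided play has so far left only vertices with children, and legal choices there
  stay in the tree.\<close>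

lemma token_in_tree:
  assumes "legal_strategy \<omega> First \<sigma>" "legal_strategy \<omega> Second \<tau>"
  shows "undecided_until \<omega> (token \<sigma> \<tau>) n \<Longrightarrow> token \<sigma> \<tau> n \<in> tree_vertices \<omega>"
proof (induction n)
  case 0
  then show ?case by (simp add: tree_vertices_def)
next
  case (Suc n)
  then have "token \<sigma> \<tau> n \<in> tree_vertices \<omega>" "num_children \<omega> (token \<sigma> \<tau> n) \<noteq> 0"
    by (auto simp: undecided_until_def)
  with assms show ?case
    by (auto simp: legal_strategy_def split: player.split intro!: tree_vertices_snoc)
qed

lemma best_play_token:
  assumes "legal_strategy \<omega> First \<sigma>" "legal_strategy \<omega> Second \<tau>"
    and "P = First \<Longrightarrow> \<sigma> = best \<omega>" "P = Second \<Longrightarrow> \<tau> = best \<omega>"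
  shows "best_play \<omega> P (token \<sigma> \<tau>)"
  using assms token_in_tree[OF assms(1,2)]
  unfolding best_play_def by (auto simp: legal_strategy_def split: player.splits)

lemma undecided_until_Suc:
  "undecided_until \<omega> x (Suc n) \<longleftrightarrow> undecided_until \<omega> x n \<and>
     num_children \<omega> (x n) \<noteq> 0 \<and> edge_label_into \<omega> (x (Suc n)) = Safe"
  by (auto simp: undecided_until_def less_Suc_eq)

lemma turn_snoc: "turn (v @ [i]) = other (turn v)"
  by (simp add: turn_def)

lemma other_eq: "other a = P \<longleftrightarrow> a \<noteq> P"
  by (cases a; cases P) auto

text \<open>Under the fastest-win strategy the bound \<open>n\<close> drops by one per move while
  \<open>wins_in\<close> and \<open>loses_in\<close> alternate. Neither holds at 0, so the play is
  decided in favour of \<open>P\<close> before the bound is used up.\<close>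

lemma best_wins:
  assumes "best_play \<omega> P x"
  shows "undecided_until \<omega> x k \<Longrightarrow> if turn (x k) = P then wins_in n \<omega> (x k) else loses_in n \<omega> (x k) \<Longrightarrow>
    play_won_by \<omega> P x"
proof (induction n arbitrary: k)
  case 0
  then show ?case by (simp split: if_splits)
next
  case (Suc n)
  obtain i where i: "x (Suc k) = x k @ [i]" "turn (x k) = P \<Longrightarrow> i = best \<omega> (x k)"
    "num_children \<omega> (x k) \<noteq> 0 \<Longrightarrow> i < num_children \<omega> (x k)"
    using assms Suc.prems(1) unfolding best_play_def by blast
  have turn: "turn (x (Suc k)) = P \<longleftrightarrow> turn (x k) \<noteq> P"
    by (simp add: i turn_snoc other_eq)
  show ?case
  proof (cases "turn (x k) = P")
    case True
    then have "wins_in (Suc n) \<omega> (x k)"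
      using Suc.prems by simp
    moreover from this have nz: "num_children \<omega> (x k) \<noteq> 0"
      by auto
    ultimately have "edge_label_into \<omega> (x (Suc k)) = Target \<or>
        edge_label_into \<omega> (x (Suc k)) = Safe \<and> loses_in n \<omega> (x (Suc k))"
      using best[OF nz] i True unfolding good_move_def by metis
    then show ?thesis
    proof
      assume "edge_label_into \<omega> (x (Suc k)) = Target"
      then show ?thesis
        using nz True Suc.prems(1) unfolding play_won_by_def by (intro exI[of _ k]) simp
    next
      assume "edge_label_into \<omega> (x (Suc k)) = Safe \<and> loses_in n \<omega> (x (Suc k))"
      then show ?thesis
        using Suc.IH[of "Suc k"] Suc.prems(1) nz turn True by (simp add: undecided_until_Suc)
    qed
  next
    case False
    then have l: "loses_in (Suc n) \<omega> (x k)"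
      using Suc.prems by simp
    show ?thesis
    proof (cases "num_children \<omega> (x k) = 0")
      case True
      then show ?thesis
        using False Suc.prems(1) unfolding play_won_by_def by (intro exI[of _ k]) simp
    next
      case nz: False
      then have "edge_label_into \<omega> (x (Suc k)) = Trap \<or>
          edge_label_into \<omega> (x (Suc k)) = Safe \<and> wins_in n \<omega> (x (Suc k))"
        using l i by simp
      then show ?thesis
      proof
        assume "edge_label_into \<omega> (x (Suc k)) = Trap"
        then show ?thesis
          using nz False Suc.prems(1) unfolding play_won_by_def by (intro exI[of _ k]) simp
      next
        assume "edge_label_into \<omega> (x (Suc k)) = Safe \<and> wins_in n \<omega> (x (Suc k))"
        then show ?thesis
          using Suc.IH[of "Suc k"] Suc.prems(1) nz turn False by (simp add: undecided_until_Suc)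
      qed
    qed
  qed
qed

text \<open>While the play is undecided, \<open>P\<close> never has to move from a losing vertex and
  never hands over a winning one. An end in favour of the opponent would violate this
  invariant.\<close>

lemma best_does_not_lose:
  assumes "best_play \<omega> P x"
    and "if turn [] = P then \<not> loses \<omega> [] else \<not> wins \<omega> []"
  shows "\<not> play_won_by \<omega> (other P) x"
proof -
  have step: "\<exists>i. x (Suc k) = x k @ [i] \<and> (turn (x k) = P \<longrightarrow> good_move \<omega> (x k) i) \<and>
    i < num_children \<omega> (x k)" if "undecided_until \<omega> x k" "num_children \<omega> (x k) \<noteq> 0" for k
    using assms(1) that best unfolding best_play_def by metis
  have inv: "if turn (x k) = P then \<not> loses \<omega> (x k) else \<not> wins \<omega> (x k)"
    if "undecided_until \<omega> x k" for k
    using that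
  proof (induction k)
    case 0
    then show ?case using assms by (simp add: best_play_def)
  next
    case (Suc k)
    then have "undecided_until \<omega> x k" "num_children \<omega> (x k) \<noteq> 0"
      and safe: "edge_label_into \<omega> (x (Suc k)) = Safe"
      and IH: "if turn (x k) = P then \<not> loses \<omega> (x k) else \<not> wins \<omega> (x k)"
      by (auto simp: undecided_until_Suc)
    then obtain i where i: "x (Suc k) = x k @ [i]" "turn (x k) = P \<Longrightarrow> good_move \<omega> (x k) i"
      "i < num_children \<omega> (x k)"
      using step by blast
    show ?case
      using IH i(2) safe winsI[OF i(3)] by (auto simp: i(1) turn_snoc other_eq good_move_def)
  qed
  have "\<not> (if num_children \<omega> (x n) = 0 then turn (x n) \<noteq> other P
           else (turn (x n) = other P \<and> edge_label_into \<omega> (x (Suc n)) = Target) \<or>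
                (turn (x n) \<noteq> other P \<and> edge_label_into \<omega> (x (Suc n)) = Trap))"
    if u: "undecided_until \<omega> x n" for n
  proof (cases "num_children \<omega> (x n) = 0")
    case True
    \<comment> \<open>A leaf is losing vacuously, so by the invariant it is the opponent who is
      stuck there.\<close>
    then have "loses \<omega> (x n)"
      by (intro losesI) simp
    with inv[OF u] True show ?thesis
      by (auto split: if_splits) (metis other_eq)
  next
    case False
    then obtain i where i: "x (Suc n) = x n @ [i]" "turn (x n) = P \<Longrightarrow> good_move \<omega> (x n) i"
      "i < num_children \<omega> (x n)"
      using step u by blast
    show ?thesis
    proof (cases "turn (x n) = P")
      case True
      then show ?thesis
        using inv[OF u] i False by (auto simp: good_move_def) (metis other_eq)+
    next
      case f: False
      then show ?thesis
        using inv[OF u] winsI[OF i(3)] False by (auto simp: i(1)) (metis other_eq)+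
    qed
  qed
  then show ?thesis
    unfolding play_won_by_def by blast
qed

text \<open>\<open>best\<close> witnesses a win from a winning root. Conversely, a winning strategy
  must also beat \<open>best\<close> in the hands of Second, which is impossible unless the root is
  winning.\<close>

lemma game_won_iff: "game_won \<omega> \<longleftrightarrow> wins \<omega> []"
proof
  assume "wins \<omega> []"
  then obtain n where n: "wins_in n \<omega> []"
    unfolding wins_def by blast
  have "play_won_by \<omega> First (token (best \<omega>) \<tau>)" if "legal_strategy \<omega> Second \<tau>" for \<tau>
    using n best_wins[OF best_play_token[OF legal_best that], where P = First and k = 0 and n = n]
    by (simp add: undecided_until_def turn_def)
  then show "game_won \<omega>"
    unfolding game_won_def using legal_best by blast
next
  assume "game_won \<omega>"
  then obtain \<sigma> where \<sigma>: "legal_strategy \<omega> First \<sigma>" "play_won_by \<omega> First (token \<sigma> (best \<omega>))"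
    unfolding game_won_def using legal_best by blast
  show "wins \<omega> []"
    using best_does_not_lose[OF best_play_token[OF \<sigma>(1) legal_best], of Second] \<sigma>(2)
    by (auto simp: turn_def)
qed

lemma game_lost_iff: "game_lost \<omega> \<longleftrightarrow> loses \<omega> []"
proof
  assume "loses \<omega> []"
  then obtain n where n: "loses_in n \<omega> []"
    unfolding loses_def by blast
  have "play_won_by \<omega> Second (token \<sigma> (best \<omega>))" if "legal_strategy \<omega> First \<sigma>" for \<sigma>
    using n best_wins[OF best_play_token[OF that legal_best], where P = Second and k = 0 and n = n]
    by (simp add: undecided_until_def turn_def)
  then show "game_lost \<omega>"
    unfolding game_lost_def using legal_best by blast
next
  assume "game_lost \<omega>"
  then obtain \<tau> where \<tau>: "legal_strategy \<omega> Second \<tau>" "play_won_by \<omega> Second (token (best \<omega>) \<tau>)"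
    unfolding game_lost_def using legal_best by blast
  show "loses \<omega> []"
    using best_does_not_lose[OF best_play_token[OF legal_best \<tau>(1)], of First] \<tau>(2)
    by (auto simp: turn_def)
qed

section \<open>Root decomposition of the labeled tree\<close>

text \<open>\<open>case_list a s\<close> glues the root value \<open>a\<close> to the fields
  \<open>s i\<close> below the letters. Measurability is checked word by word, where the map is a
  composition of projections.\<close>

lemma measurable_case_list:
  fixes D :: "'a measure"
  defines "M \<equiv> PiM (UNIV :: 'i list set) (\<lambda>_. D)"
  shows "(\<lambda>(a, s). case_list a s) \<in> D \<Otimes>\<^sub>M PiM (UNIV :: 'i set) (\<lambda>_. M) \<rightarrow>\<^sub>M M"
proof -
  have coord: "(\<lambda>x. (case x of (a, s) \<Rightarrow> case_list a s) v) \<in>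
      D \<Otimes>\<^sub>M PiM (UNIV :: 'i set) (\<lambda>_. M) \<rightarrow>\<^sub>M D" for v :: "'i list"
  proof (cases v)
    case (Cons i u)
    have s: "(\<lambda>s. s i) \<in> PiM (UNIV :: 'i set) (\<lambda>_. M) \<rightarrow>\<^sub>M M"
      by simp
    have u: "(\<lambda>\<omega>. \<omega> u) \<in> M \<rightarrow>\<^sub>M D"
      by (simp add: M_def)
    have "(\<lambda>x. snd x i u) \<in> D \<Otimes>\<^sub>M PiM (UNIV :: 'i set) (\<lambda>_. M) \<rightarrow>\<^sub>M D"
      by (rule measurable_compose[OF measurable_snd measurable_compose[OF s u]])
    then show ?thesis
      by (simp add: Cons case_prod_beta)
  qed (simp add: case_prod_beta)
  show ?thesis
    unfolding M_def
  proof (rule measurable_PiM_single'[OF coord[unfolded M_def]])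
    show "(\<lambda>x v. (case x of (a, s) \<Rightarrow> case_list a s) v) \<in>
        space (D \<Otimes>\<^sub>M PiM (UNIV :: 'i set) (\<lambda>_. PiM UNIV (\<lambda>_. D))) \<rightarrow> (\<Pi>\<^sub>E v\<in>UNIV. space D)"
      using measurable_space[OF coord[unfolded M_def]] by (intro funcsetI PiE_I) simp_all
  qed
qed

text \<open>A random field indexed by words consists of its value at the empty word and of independent
  copies of itself, one below each letter.\<close>

lemma distr_PiM_list:
  fixes D :: "'a measure"
  assumes "prob_space D"
  defines "M \<equiv> PiM (UNIV :: 'i list set) (\<lambda>_. D)"
  shows "distr (D \<Otimes>\<^sub>M PiM (UNIV :: 'i set) (\<lambda>_. M)) M (\<lambda>(a, s). case_list a s) = M"
proof -
  interpret D: prob_space D by fact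
  interpret M: product_prob_space "\<lambda>_. D" "UNIV :: 'i list set" ..
  have "prob_space M"
    unfolding M_def by (rule M.P.prob_space_axioms)
  then interpret MM: prob_space M .
  define S where "S = PiM (UNIV :: 'i set) (\<lambda>_. M)"
  interpret S: product_prob_space "\<lambda>_. M" "UNIV :: 'i set" ..
  have "prob_space S"
    unfolding S_def by (rule S.P.prob_space_axioms)
  then interpret SS: prob_space S .
  have T: "(\<lambda>(a, s). case_list a s) \<in> D \<Otimes>\<^sub>M S \<rightarrow>\<^sub>M M"
    unfolding S_def M_def by (rule measurable_case_list)
  have "distr (D \<Otimes>\<^sub>M S) M (\<lambda>(a, s). case_list a s) = M"
    unfolding M_def
  proof (rule M.PiM_eq)
    show "sets (distr (D \<Otimes>\<^sub>M S) (PiM UNIV (\<lambda>_. D)) (\<lambda>(a, s). case_list a s)) = sets (PiM UNIV (\<lambda>_. D))"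
      by simp
    fix J :: "'i list set" and F
    assume J: "finite J" and F: "\<And>j. j \<in> J \<Longrightarrow> F j \<in> sets D"
    \<comment> \<open>\<open>H\<close> collects the first letters of the nonempty words in
      \<open>J\<close>, and \<open>K i\<close> the remainders after \<open>i\<close>;
      \<open>A\<close> and \<open>G i\<close> are the constraints that the cylinder over
      \<open>J\<close> imposes on the root and on the field below \<open>i\<close>.\<close>
    define H where "H = hd ` (J - {[]})"
    define K where "K i = {u. i # u \<in> J}" for i
    define G where "G i = {\<omega> \<in> space M. \<forall>u\<in>K i. \<omega> u \<in> F (i # u)}" for i
    define A where "A = (if [] \<in> J then F [] else space D)"
    have finH: "finite H" and finK: "finite (K i)" for i
      using J finite_vimageI[of J "(#) i"] by (auto simp: H_def K_def vimage_def inj_def)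
    have H: "i \<in> H \<longleftrightarrow> K i \<noteq> {}" for i
    proof
      assume "i \<in> H"
      then obtain j where "j \<in> J" "j \<noteq> []" "i = hd j"
        by (auto simp: H_def)
      then show "K i \<noteq> {}"
        by (cases j) (auto simp: K_def)
    next
      assume "K i \<noteq> {}"
      then obtain u where "i # u \<in> J - {[]}"
        by (auto simp: K_def)
      then show "i \<in> H"
        unfolding H_def by (intro image_eqI[of _ _ "i # u"]) auto
    qed
    have G: "emeasure M (G i) = (\<Prod>u\<in>K i. emeasure D (F (i # u)))" for i
      unfolding G_def M_def using finK F by (intro M.emeasure_PiM_Collect) (auto simp: K_def)
    have G_sets: "G i \<in> sets M" for i
    proof -
      have "{\<omega> \<in> space M. \<forall>u\<in>K i. \<omega> u \<in> F (i # u)} \<in> sets M"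
        using finK F unfolding M_def by (intro sets.sets_Collect_finite_All sets_Collect_single) (auto simp: K_def)
      then show ?thesis by (simp add: G_def)
    qed
    have A_sets: "A \<in> sets D"
      using F by (simp add: A_def)
    define E where "E = {s \<in> space S. \<forall>i\<in>H. s i \<in> G i}"
    have E: "emeasure S E = (\<Prod>i\<in>H. emeasure M (G i))"
      unfolding E_def S_def using finH G_sets by (intro S.emeasure_PiM_Collect) auto
    have E_sets: "E \<in> sets S"
      using finH G_sets unfolding E_def S_def
      by (intro sets.sets_Collect_finite_All sets_Collect_single) auto
    have J_eq: "J = (J \<inter> {[]}) \<union> (\<lambda>(i, u). i # u) ` Sigma H K"
      using H by (auto simp: K_def image_iff) (metis neq_Nil_conv empty_iff mem_Collect_eq)
    \<comment> \<open>The preimage of a cylinder under gluing is a rectangle, so its measure factors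
      into a root part and a part for the children.\<close>
    have vim: "(\<lambda>(a, s). case_list a s) -` prod_emb UNIV (\<lambda>_. D) J (Pi\<^sub>E J F) \<inter> space (D \<Otimes>\<^sub>M S) = A \<times> E"
    proof -
      have *: "(\<forall>j\<in>J. case_list a s j \<in> F j) \<longleftrightarrow> a \<in> A \<and> s \<in> E" if "a \<in> space D" "s \<in> space S" for a s
      proof -
        have sp: "s i \<in> space M" for i
          using that by (auto simp: S_def space_PiM)
        have "(\<forall>j\<in>J. case_list a s j \<in> F j) \<longleftrightarrow>
            ([] \<in> J \<longrightarrow> a \<in> F []) \<and> (\<forall>i\<in>H. \<forall>u\<in>K i. s i u \<in> F (i # u))"
        proof -
          have "(\<forall>j\<in>J. case_list a s j \<in> F j) \<longleftrightarrow>
              ([] \<in> J \<longrightarrow> a \<in> F []) \<and> (\<forall>i u. i # u \<in> J \<longrightarrow> s i u \<in> F (i # u))"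
            by (auto split: list.split)
          then show ?thesis
            using H by (auto simp: K_def)
        qed
        then show ?thesis
          using that sp by (auto simp: A_def E_def G_def)
      qed
      have sp: "case_list a s \<in> space M" if "a \<in> space D" "s \<in> space S" for a s
        using measurable_space[OF T, of "(a, s)"] that by (simp add: space_pair_measure)
      have sub: "A \<subseteq> space D" "E \<subseteq> space S"
        using A_sets E_sets sets.sets_into_space by auto
      have emb: "prod_emb UNIV (\<lambda>_. D) J (Pi\<^sub>E J F) = {\<omega> \<in> space M. \<forall>j\<in>J. \<omega> j \<in> F j}"
        by (auto simp: prod_emb_def M_def space_PiM PiE_iff)
      have "(a, s) \<in> (\<lambda>(a, s). case_list a s) -` {\<omega> \<in> space M. \<forall>j\<in>J. \<omega> j \<in> F j} \<inter> space (D \<Otimes>\<^sub>M S) \<longleftrightarrow>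
          (a, s) \<in> A \<times> E" for a s
      proof (cases "a \<in> space D \<and> s \<in> space S")
        case True
        then show ?thesis
          using *[of a s] sp[of a s] by (simp add: space_pair_measure)
      next
        case False
        then show ?thesis
          using sub by (auto simp: space_pair_measure)
      qed
      then show ?thesis
        unfolding emb by auto
    qed
    have "emeasure (distr (D \<Otimes>\<^sub>M S) M (\<lambda>(a, s). case_list a s)) (prod_emb UNIV (\<lambda>_. D) J (Pi\<^sub>E J F))
        = emeasure (D \<Otimes>\<^sub>M S) (A \<times> E)"
      using T J F by (subst emeasure_distr) (auto simp: vim M_def intro!: sets_PiM_I)
    also have "\<dots> = emeasure D A * emeasure S E"
      using A_sets E_sets by (rule SS.emeasure_pair_measure_Times)
    also have "emeasure S E = (\<Prod>(i, u)\<in>Sigma H K. emeasure D (F (i # u)))"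
      using finH finK by (simp add: E G prod.Sigma)
    also have "\<dots> = (\<Prod>j\<in>(\<lambda>(i, u). i # u) ` Sigma H K. emeasure D (F j))"
      by (subst prod.reindex) (auto simp: inj_on_def case_prod_beta)
    \<comment> \<open>If \<open>[]\<close> is not in \<open>J\<close>, both sides are 1 because
      \<open>D\<close> has total mass 1.\<close>
    also have "emeasure D A = (\<Prod>j\<in>J \<inter> {[]}. emeasure D (F j))"
      by (simp add: A_def D.emeasure_space_1)
    also have "\<dots> * (\<Prod>j\<in>(\<lambda>(i, u). i # u) ` Sigma H K. emeasure D (F j)) = (\<Prod>j\<in>J. emeasure D (F j))"
    proof -
      have "(\<Prod>j\<in>J. emeasure D (F j)) = (\<Prod>j\<in>J \<inter> {[]} \<union> (\<lambda>(i, u). i # u) ` Sigma H K. emeasure D (F j))"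
        by (rule prod.cong[OF J_eq refl])
      also have "\<dots> = (\<Prod>j\<in>J \<inter> {[]}. emeasure D (F j)) * (\<Prod>j\<in>(\<lambda>(i, u). i # u) ` Sigma H K. emeasure D (F j))"
        using finH finK by (intro prod.union_disjoint) auto
      finally show ?thesis ..
    qed
    finally show "emeasure (distr (D \<Otimes>\<^sub>M S) (PiM UNIV (\<lambda>_. D)) (\<lambda>(a, s). case_list a s))
        (prod_emb UNIV (\<lambda>_. D) J (Pi\<^sub>E J F)) = (\<Prod>j\<in>J. emeasure D (F j))"
      by (simp add: M_def)
  qed
  then show ?thesis
    by (simp add: S_def)
qed

section \<open>Poisson offspring and events at the root\<close>

lemma nn_integral_poisson_power:
  assumes "lam > 0" "b \<ge> 0"
  shows "(\<integral>\<^sup>+k. ennreal (b ^ k) \<partial>measure_pmf (poisson_pmf lam)) = ennreal (exp (- lam * (1 - b)))"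
proof -
  \<comment> \<open>The generating function of the Poisson law at \<open>b\<close>: the series of
    \<open>exp (lam * b)\<close>, weighted by \<open>exp (- lam)\<close>.\<close>
  have "(\<lambda>k. (lam * b) ^ k /\<^sub>R fact k * exp (- lam)) sums (exp (lam * b) * exp (- lam))"
    by (intro sums_mult2 exp_converges)
  then have sums: "(\<lambda>k. pmf (poisson_pmf lam) k * b ^ k) sums exp (- lam * (1 - b))"
    using assms by (simp add: power_mult_distrib field_simps flip: exp_add)
  have "(\<integral>\<^sup>+k. ennreal (b ^ k) \<partial>measure_pmf (poisson_pmf lam)) =
      (\<Sum>k. ennreal (pmf (poisson_pmf lam) k * b ^ k))"
    unfolding nn_integral_measure_pmf nn_integral_count_space_nat
    using assms by (intro suminf_cong ennreal_mult[symmetric]) auto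
  also have "\<dots> = ennreal (exp (- lam * (1 - b)))"
    by (rule suminf_ennreal_eq[OF _ sums]) (use assms in simp)
  finally show ?thesis .
qed

text \<open>Given \<open>k\<close> children, their subtrees are independent copies of the tree, so
  all lie in \<open>B\<close> with probability \<open>measure M B ^ k\<close>; averaging over
  \<open>k\<close> gives the Poisson generating function. The label set \<open>L\<close> is carried
  along because, seen from a child, the root label is the label of the edge into that child.\<close>

lemma measure_labeled_GW_root:
  fixes L :: "edge_label set" and lam p q :: real
  assumes lam: "lam > 0"
  defines "M \<equiv> labeled_GW (poisson_pmf lam) p q"
  assumes B: "B \<in> sets M"
  shows "measure M {\<omega>. edge_label_into \<omega> [] \<in> L \<and> (\<forall>i<num_children \<omega> []. (\<lambda>u. \<omega> (i # u)) \<in> B)}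
    = measure_pmf.prob (label_pmf p q) L * exp (- lam * (1 - measure M B))"
proof -
  define D where "D = pair_pmf (poisson_pmf lam) (label_pmf p q)"
  have M_eq: "M = PiM UNIV (\<lambda>_. measure_pmf D)"
    by (simp add: M_def labeled_GW_def D_def)
  have "prob_space M"
    unfolding M_eq by (intro prob_space_PiM measure_pmf.prob_space_axioms)
  then interpret M: prob_space M .
  define S where "S = PiM (UNIV :: nat set) (\<lambda>_. M)"
  interpret S: product_prob_space "\<lambda>_. M" "UNIV :: nat set" ..
  have "prob_space S"
    unfolding S_def by (rule S.P.prob_space_axioms)
  then interpret SS: prob_space S .
  have dist: "distr (measure_pmf D \<Otimes>\<^sub>M S) M (\<lambda>(a, s). case_list a s) = M"
    unfolding S_def M_eq by (rule distr_PiM_list) (rule measure_pmf.prob_space_axioms)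
  have spM: "space M = UNIV" and spS: "space S = UNIV"
    by (auto simp: M_eq S_def space_PiM)
  let ?X = "{\<omega>. edge_label_into \<omega> [] \<in> L \<and> (\<forall>i<num_children \<omega> []. (\<lambda>u. \<omega> (i # u)) \<in> B)}"
  let ?Y = "{(a, s). snd a \<in> L \<and> (\<forall>i<fst a. s i \<in> B)} :: ((nat \<times> edge_label) \<times> (nat \<Rightarrow> realization)) set"
  have X_sets: "?X \<in> sets M"
  proof -
    have sub: "(\<lambda>\<omega> u. \<omega> (i # u)) \<in> M \<rightarrow>\<^sub>M M" for i
      unfolding M_eq by (rule measurable_PiM_single') auto
    have [measurable]: "Measurable.pred M (\<lambda>\<omega>. (\<lambda>u. \<omega> (i # u)) \<in> B)" for i
      using measurable_sets[OF sub B] by (simp add: pred_def spM vimage_def)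
    have r: "(\<lambda>\<omega>. \<omega> []) \<in> M \<rightarrow>\<^sub>M count_space UNIV"
      unfolding M_eq by measurable
    have [measurable]: "Measurable.pred M (\<lambda>\<omega>. snd (\<omega> []) \<in> L)"
      "Measurable.pred M (\<lambda>\<omega>. i < fst (\<omega> []))" for i
      by (rule measurable_compose[OF r]; simp)+
    have "Measurable.pred M (\<lambda>\<omega>. snd (\<omega> []) \<in> L \<and> (\<forall>i. i < fst (\<omega> []) \<longrightarrow> (\<lambda>u. \<omega> (i # u)) \<in> B))"
      by measurable
    then show ?thesis
      by (simp add: pred_def spM edge_label_into_def num_children_def)
  qed
  have T: "(\<lambda>(a, s). case_list a s) \<in> measure_pmf D \<Otimes>\<^sub>M S \<rightarrow>\<^sub>M M"
    unfolding S_def M_eq by (rule measurable_case_list)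
  have vim: "(\<lambda>(a, s). case_list a s) -` ?X \<inter> space (measure_pmf D \<Otimes>\<^sub>M S) = ?Y"
    by (auto simp: space_pair_measure spS edge_label_into_def num_children_def)
  have Y_sets: "?Y \<in> sets (measure_pmf D \<Otimes>\<^sub>M S)"
    using measurable_sets[OF T X_sets] unfolding vim .
  \<comment> \<open>The section over fixed root data \<open>a\<close> is a cylinder in the first
    \<open>fst a\<close> coordinates, or empty if the label is not in \<open>L\<close>.\<close>
  have sec: "emeasure S (Pair a -` ?Y) = indicator L (snd a) * ennreal (measure M B ^ fst a)" for a
  proof -
    have "emeasure S {s \<in> space S. \<forall>i\<in>{..<fst a}. s i \<in> B} = (\<Prod>i<fst a. emeasure M B)"
      unfolding S_def using B by (intro S.emeasure_PiM_Collect) auto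
    moreover have "Pair a -` ?Y = (if snd a \<in> L then {s \<in> space S. \<forall>i\<in>{..<fst a}. s i \<in> B} else {})"
      by (auto simp: spS)
    ultimately show ?thesis
      by (simp add: M.emeasure_eq_measure ennreal_power)
  qed
  have "emeasure M ?X = emeasure (distr (measure_pmf D \<Otimes>\<^sub>M S) M (\<lambda>(a, s). case_list a s)) ?X"
    by (simp add: dist)
  also have "\<dots> = emeasure (measure_pmf D \<Otimes>\<^sub>M S) ?Y"
    using emeasure_distr[OF T X_sets] unfolding vim .
  also have "\<dots> = (\<integral>\<^sup>+a. indicator L (snd a) * ennreal (measure M B ^ fst a) \<partial>measure_pmf D)"
    unfolding SS.emeasure_pair_measure_alt[OF Y_sets] sec ..
  also have "\<dots> = (\<integral>\<^sup>+k. emeasure (label_pmf p q) L * ennreal (measure M B ^ k) \<partial>measure_pmf (poisson_pmf lam))"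
    by (simp add: D_def nn_integral_pair_pmf' nn_integral_multc)
  also have "\<dots> = emeasure (label_pmf p q) L * ennreal (exp (- lam * (1 - measure M B)))"
    unfolding nn_integral_poisson_power[OF lam measure_nonneg, symmetric] by (rule nn_integral_cmult) simp
  also have "\<dots> = ennreal (measure_pmf.prob (label_pmf p q) L * exp (- lam * (1 - measure M B)))"
    by (simp add: measure_pmf.emeasure_eq_measure ennreal_mult)
  finally show ?thesis
    by (rule measure_eq_emeasure_eq_ennreal[rotated]) simp
qed

section \<open>Two-cycles of the exponential map\<close>

text \<open>Both \<open>y\<close> and \<open>z\<close> are zeros of \<open>F\<close>, the identity
  minus the second iterate of \<open>t \<mapsto> B * exp (- t)\<close>. With
  \<open>u = B * exp (- t)\<close> its derivative is \<open>1 - B * u * exp (- u)\<close>, which is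
  nonnegative and vanishes at most where \<open>u = 1\<close>. This isolated zero is what settles
  the borderline \<open>B = exp 1\<close>.\<close>

lemma exp_two_cycle_unique:
  fixes B y z :: real
  assumes "0 < B" "B \<le> exp 1" "y = B * exp (- z)" "z = B * exp (- y)"
  shows "y = z"
proof (rule ccontr)
  define F where "F t = t - B * exp (- (B * exp (- t)))" for t
  define F' where "F' t = 1 - B * (B * exp (- t) * exp (- (B * exp (- t))))" for t
  have deriv: "(F has_real_derivative F' t) (at t)" for t
    unfolding F_def F'_def by (auto intro!: derivative_eq_intros simp: algebra_simps)
  have bound: "u * exp (- u) < exp (- 1)" if "u \<noteq> 1" for u :: real
  proof -
    \<comment> \<open>The strict tangent line bound \<open>1 + s < exp s\<close>, taken at
      \<open>s = u - 1\<close>.\<close>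
    have "u < exp (u - 1)"
      using that exp_minus_greater[of "1 - u"] by simp
    then have "u * exp (- u) < exp (u - 1) * exp (- u)"
      by simp
    then show ?thesis
      by (simp flip: exp_add)
  qed
  have B: "B * exp (- 1) \<le> 1"
    using assms(2) by (simp add: exp_minus field_simps)
  have pos: "F' t > 0" if "B * exp (- t) \<noteq> 1" for t
  proof -
    have "B * (B * exp (- t) * exp (- (B * exp (- t)))) < B * exp (- 1)"
      using bound[OF that] assms(1) by simp
    with B show ?thesis
      unfolding F'_def by simp
  qed
  have nonneg: "F' t \<ge> 0" for t
    using pos[of t] B by (cases "B * exp (- t) = 1") (auto simp: F'_def)
  define a b where "a = min y z" and "b = max y z"
  assume "y \<noteq> z"
  then have "a < b" by (auto simp: a_def b_def)
  have "F a = 0" "F b = 0"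
    using assms(3,4) unfolding F_def a_def b_def min_def max_def by auto
  \<comment> \<open>Monotonicity forces \<open>F = 0\<close> at the midpoint too. The mean value
    theorem on either half then gives two distinct zeros of \<open>F'\<close>, although only the
    point with \<open>B * exp (- t) = 1\<close> can be one.\<close>
  define m where "m = (a + b) / 2"
  have m: "a < m" "m < b"
    using \<open>a < b\<close> by (auto simp: m_def)
  have mono: "s \<le> t \<Longrightarrow> F s \<le> F t" for s t
    using DERIV_nonneg_imp_nondecreasing deriv nonneg by blast
  have "F m = 0"
    using mono[of a m] mono[of m b] m \<open>F a = 0\<close> \<open>F b = 0\<close> by simp
  obtain c where c: "a < c" "c < m" "F m - F a = (m - a) * F' c"
    using MVT2[OF m(1), of F F'] deriv by blast
  obtain d where d: "m < d" "d < b" "F b - F m = (b - m) * F' d"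
    using MVT2[OF m(2), of F F'] deriv by blast
  have "F' c = 0" "F' d = 0"
    using c d m \<open>F a = 0\<close> \<open>F b = 0\<close> \<open>F m = 0\<close> by auto
  then have "B * exp (- c) = B * exp (- d)"
    using pos[of c] pos[of d] by (metis less_irrefl)
  then show False
    using assms(1) c d by simp
qed

text \<open>By continuity \<open>g\<close> exchanges \<open>v'\<close> and \<open>l'\<close>. Under
  the bound such a 2-cycle collapses to a fixed point. If the limits agree but the bound fails, the
  fixed point repels, so some \<open>l n\<close> just below it would decrease in two steps, against
  monotonicity.\<close>

lemma two_step_iteration_limit:
  fixes lam q r :: real and v l :: "nat \<Rightarrow> real"
  defines "g \<equiv> \<lambda>x. exp (- lam * (q + r * x))"
  assumes lam: "lam > 0" and q: "q \<ge> 0" and r: "r > 0"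
    and v0: "v 0 = 1" and l0: "l 0 = 0"
    and vS: "\<And>n. v (Suc n) = g (l n)" and lS: "\<And>n. l (Suc n) = g (v n)"
    and mono_l: "\<And>n. l n \<le> l (Suc n)"
    and v: "v \<longlonglongrightarrow> v'" and l: "l \<longlonglongrightarrow> l'"
  shows "v' = l' \<longleftrightarrow> r * lam * exp (- lam * q) \<le> exp 1"
proof -
  \<comment> \<open>Multiplication by \<open>A\<close> conjugates \<open>g\<close> to
    \<open>y \<mapsto> B * exp (- y)\<close>.\<close>
  define A B where "A = lam * r" and "B = r * lam * exp (- lam * q)"
  have A: "A > 0" and B: "B > 0"
    using lam r by (auto simp: A_def B_def)
  have g: "A * g x = B * exp (- (A * x))" for x
    by (simp add: g_def A_def B_def algebra_simps flip: exp_add)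
  have g_less: "x < y \<Longrightarrow> g y < g x" for x y
    using lam r by (simp add: g_def)
  have cont: "isCont g x" for x
    unfolding g_def by (intro continuous_intros)
  have fix_v: "v' = g l'"
    using LIMSEQ_unique[OF LIMSEQ_Suc[OF v]] isCont_tendsto_compose[OF cont l] by (simp add: vS)
  have fix_l: "l' = g v'"
    using LIMSEQ_unique[OF LIMSEQ_Suc[OF l]] isCont_tendsto_compose[OF cont v] by (simp add: lS)
  show ?thesis
  proof
    assume "r * lam * exp (- lam * q) \<le> exp 1"
    then have "A * v' = A * l'"
      using exp_two_cycle_unique[of B "A * v'" "A * l'"] fix_v fix_l g B by (metis B_def)
    then show "v' = l'"
      using A by simp
  next
    assume eq: "v' = l'"
    show "r * lam * exp (- lam * q) \<le> exp 1"
    proof (rule ccontr)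
      assume "\<not> r * lam * exp (- lam * q) \<le> exp 1"
      then have "B > exp 1" by (simp add: B_def)
      have fp: "g l' = l'" using fix_l eq by simp
      then have "A * l' = B * exp (- (A * l'))"
        using g[of l'] by simp
      \<comment> \<open>For \<open>A * l' \<le> 1\<close> the right side of the fixed point equation
        would exceed \<open>exp 1 * exp (- 1) = 1\<close>.\<close>
      have gt1: "A * l' > 1"
      proof (rule ccontr)
        assume *: "\<not> A * l' > 1"
        have "exp 1 * exp (- 1) < B * exp (- (A * l'))"
          using * \<open>B > exp 1\<close> by (intro mult_less_le_imp_less) auto
        with * \<open>A * l' = B * exp (- (A * l'))\<close> show False
          by (simp flip: exp_add)
      qed
      \<comment> \<open>The decreasing map \<open>g\<close> swaps the two sides of its fixed point,
        and \<open>0 < l' < 1\<close> starts the induction. Strictness matters, since the sign of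
        \<open>F\<close> will be known only strictly to the left of \<open>l'\<close>.\<close>
      have l_less: "l n < l'" for n
      proof -
        have "l n < l' \<and> v n > l'"
        proof (induction n)
          case 0
          have "l' > 0" "l' = g l'" using fp by (auto simp: g_def) (metis exp_gt_zero)
          moreover have "g l' < 1"
            using lam q r \<open>l' > 0\<close> by (simp add: g_def add_nonneg_pos)
          ultimately show ?case using v0 l0 by simp
        next
          case (Suc n)
          then show ?case using g_less fp by (metis vS lS)
        qed
        then show ?thesis ..
      qed
      \<comment> \<open>Since \<open>g' = - A * g\<close>, the second iterate has slope
        \<open>(A * l')^2 > 1\<close> at \<open>l'\<close>. Hence \<open>F\<close> is positive just
        to the left of \<open>l'\<close>, where two steps lead further away.\<close>
      define F where "F t = t - g (g t)" for t
      have dg: "(g has_real_derivative (- A * g x)) (at x)" for x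
        unfolding g_def A_def by (auto intro!: derivative_eq_intros simp: algebra_simps)
      have "(F has_real_derivative (1 - (A * l') * (A * l'))) (at l')"
        using DERIV_diff[OF DERIV_ident DERIV_chain2[OF dg dg], of l']
        by (simp add: F_def[abs_def] fp)
      moreover have "1 - (A * l') * (A * l') < 0"
        using gt1 mult_strict_mono[of 1 "A * l'" 1 "A * l'"] by simp
      ultimately obtain d where d: "d > 0" "\<And>h. h > 0 \<Longrightarrow> h < d \<Longrightarrow> F l' < F (l' - h)"
        using DERIV_neg_dec_left by blast
      have "F l' = 0" by (simp add: F_def fp)
      have "\<forall>\<^sub>F n in sequentially. l n > l' - d"
        using l d(1) order_tendstoD(1)[of l l' sequentially "l' - d"] by simp
      then obtain n where "l n > l' - d"
        by (auto simp: eventually_sequentially)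
      then have "0 < F (l n)"
        using d(2)[of "l' - l n"] l_less[of n] \<open>F l' = 0\<close> by simp
      then have "l (Suc (Suc n)) < l n"
        by (simp add: F_def lS vS)
      with mono_l[of n] mono_l[of "Suc n"] show False by simp
    qed
  qed
qed

section \<open>The probability of a draw\<close>

lemma pred_wins_in_loses_in:
  fixes chi p q
  defines "M \<equiv> labeled_GW chi p q"
  shows "Measurable.pred M (\<lambda>\<omega>. wins_in n \<omega> v) \<and> Measurable.pred M (\<lambda>\<omega>. loses_in n \<omega> v)"
proof (induction n arbitrary: v)
  case (Suc n)
  have coord: "(\<lambda>\<omega>. \<omega> v) \<in> M \<rightarrow>\<^sub>M count_space UNIV" for v
    unfolding M_def labeled_GW_def by measurable
  have [measurable]: "Measurable.pred M (\<lambda>\<omega>. i < num_children \<omega> v)"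
    "Measurable.pred M (\<lambda>\<omega>. edge_label_into \<omega> v = e)" for i v e
    unfolding num_children_def edge_label_into_def by (rule measurable_compose[OF coord]; simp)+
  have [measurable]: "Measurable.pred M (\<lambda>\<omega>. wins_in n \<omega> v)"
    "Measurable.pred M (\<lambda>\<omega>. loses_in n \<omega> v)" for v
    using Suc by auto
  show ?case
    unfolding wins_in.simps loses_in.simps by measurable
qed simp

lemma space_labeled_GW: "space (labeled_GW chi p q) = UNIV"
  by (simp add: labeled_GW_def space_PiM)

text \<open>Seen from a child, \<open>N n\<close> says that moving there forces no win within the
  bound, and \<open>W n\<close> that moving there loses within it; both read the label of the
  entered edge at the shifted root. The root formula applies to these sets, whose complements have
  mass \<open>q + (1 - p - q) * l n\<close> and \<open>q + (1 - p - q) * v n\<close>.\<close>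

lemma measure_wins_in_loses_in:
  fixes lam p q :: real and n :: nat
  assumes lam: "lam > 0" and p: "0 \<le> p" and q: "0 \<le> q" and pq: "p + q \<le> 1"
  defines "M \<equiv> labeled_GW (poisson_pmf lam) p q"
  defines "v \<equiv> \<lambda>n. measure M {\<omega>. \<not> wins_in n \<omega> []}"
    and "l \<equiv> \<lambda>n. measure M {\<omega>. loses_in n \<omega> []}"
    and "g \<equiv> \<lambda>x. exp (- lam * (q + (1 - p - q) * x))"
  shows "v (Suc n) = g (l n)" and "l (Suc n) = g (v n)"
proof -
  interpret M: prob_space M
    unfolding M_def labeled_GW_def by (intro prob_space_PiM measure_pmf.prob_space_axioms)
  have spM: "space M = UNIV"
    unfolding M_def by (rule space_labeled_GW)
  have sets: "{\<omega>. wins_in n \<omega> u} \<in> sets M" "{\<omega>. loses_in n \<omega> u} \<in> sets M" for n u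
    using pred_wins_in_loses_in[where chi = "poisson_pmf lam" and p = p and q = q and n = n and v = u] spM by (auto simp: pred_def M_def)
  have lab_sets: "{\<omega>. edge_label_into \<omega> [] = e} \<in> sets M" for e
  proof -
    have "(\<lambda>\<omega>. \<omega> []) \<in> M \<rightarrow>\<^sub>M count_space UNIV"
      unfolding M_def labeled_GW_def by measurable
    then have "(\<lambda>\<omega>. snd (\<omega> [])) \<in> M \<rightarrow>\<^sub>M count_space UNIV"
      by (rule measurable_compose) simp
    from measurable_sets[OF this, of "{e}"] show ?thesis
      by (simp add: spM edge_label_into_def vimage_def)
  qed
  have lab: "measure M {\<omega>. edge_label_into \<omega> [] = e} = pmf (label_pmf p q) e" for e
  proof -
    have "UNIV \<in> sets M" "measure M UNIV = 1"
      using sets.top[of M] M.prob_space unfolding spM by auto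
    then show ?thesis
      using measure_labeled_GW_root[OF lam, of UNIV p q "{e}"]
      by (simp add: M_def measure_pmf_single)
  qed
  define W where "W n = {\<omega>. edge_label_into \<omega> [] = Trap \<or> edge_label_into \<omega> [] = Safe \<and> wins_in n \<omega> []}" for n
  define N where "N n = {\<omega>. \<not> (edge_label_into \<omega> [] = Target \<or> edge_label_into \<omega> [] = Safe \<and> loses_in n \<omega> [])}" for n
  have W_eq: "W n = ({\<omega>. edge_label_into \<omega> [] = Trap} \<union> {\<omega>. edge_label_into \<omega> [] = Safe} \<inter> {\<omega>. wins_in n \<omega> []})"
    and N_eq: "N n = space M - ({\<omega>. edge_label_into \<omega> [] = Target} \<union> {\<omega>. edge_label_into \<omega> [] = Safe} \<inter> {\<omega>. loses_in n \<omega> []})" for n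
    by (auto simp: W_def N_def spM)
  have W_sets: "W n \<in> sets M" and N_sets: "N n \<in> sets M" for n
    unfolding W_eq N_eq using sets lab_sets by auto
  have lose_step: "loses_in (Suc n) \<omega> [] \<longleftrightarrow> (\<forall>i<num_children \<omega> []. (\<lambda>u. \<omega> (i # u)) \<in> W n)"
    and win_step: "\<not> wins_in (Suc n) \<omega> [] \<longleftrightarrow> (\<forall>i<num_children \<omega> []. (\<lambda>u. \<omega> (i # u)) \<in> N n)" for n \<omega>
    by (auto simp: W_def N_def wins_in_shift edge_label_into_def)
  \<comment> \<open>Stated for every \<open>L\<close>: \<open>UNIV\<close> gives the plain
    probability and \<open>{Safe}\<close> the joint one with the root label.\<close>
  have l_Suc: "measure M {\<omega>. edge_label_into \<omega> [] \<in> L \<and> loses_in (Suc n) \<omega> []} =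
      measure_pmf.prob (label_pmf p q) L * exp (- lam * (1 - measure M (W n)))"
    and v_Suc: "measure M {\<omega>. edge_label_into \<omega> [] \<in> L \<and> \<not> wins_in (Suc n) \<omega> []} =
      measure_pmf.prob (label_pmf p q) L * exp (- lam * (1 - measure M (N n)))" for L n
    unfolding lose_step win_step using measure_labeled_GW_root[OF lam] W_sets N_sets
    by (simp_all add: M_def)
  text \<open>The label at the root is independent of the outcome of the game.\<close>
  have l_lab: "measure M {\<omega>. edge_label_into \<omega> [] = Safe \<and> loses_in n \<omega> []} = (1 - p - q) * l n" for n
    using l_Suc[of "{Safe}"] l_Suc[of UNIV] pmf_label_pmf[OF p q pq]
    by (cases n) (auto simp: l_def measure_pmf_single)
  \<comment> \<open>At \<open>n = 0\<close> the condition on the game is void and only the label law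
    \<open>lab\<close> remains.\<close>
  have v_lab: "measure M {\<omega>. edge_label_into \<omega> [] = Safe \<and> \<not> wins_in n \<omega> []} = (1 - p - q) * v n" for n
    using v_Suc[of "{Safe}"] v_Suc[of UNIV] pmf_label_pmf[OF p q pq] M.prob_space spM
    by (cases n) (auto simp: v_def measure_pmf_single lab)
  have compl: "1 - measure M A = measure M {\<omega>. edge_label_into \<omega> [] = Target} + measure M C"
    if "A \<in> sets M" "C \<in> sets M" "- A = {\<omega>. edge_label_into \<omega> [] = Target} \<union> C"
      "{\<omega>. edge_label_into \<omega> [] = Target} \<inter> C = {}" for A C
  proof -
    have "1 - measure M A = measure M (- A)"
      using M.prob_compl[OF that(1)] by (simp add: spM Compl_eq_Diff_UNIV)
    then show ?thesis
      unfolding that(3) using M.finite_measure_Union[OF lab_sets that(2,4)] by simp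
  qed
  have N: "1 - measure M (N n) = q + (1 - p - q) * l n" for n
  proof -
    have "1 - measure M (N n) = measure M {\<omega>. edge_label_into \<omega> [] = Target} +
        measure M {\<omega>. edge_label_into \<omega> [] = Safe \<and> loses_in n \<omega> []}"
    proof (rule compl[OF N_sets])
      show "{\<omega>. edge_label_into \<omega> [] = Safe \<and> loses_in n \<omega> []} \<in> sets M"
        unfolding Collect_conj_eq using lab_sets sets(2) by (rule sets.Int)
    qed (auto simp: N_def)
    then show ?thesis
      using l_lab[of n] lab[of Target] pmf_label_pmf[OF p q pq] by simp
  qed
  have W: "1 - measure M (W n) = q + (1 - p - q) * v n" for n
  proof -
    have "1 - measure M (W n) = measure M {\<omega>. edge_label_into \<omega> [] = Target} +
        measure M {\<omega>. edge_label_into \<omega> [] = Safe \<and> \<not> wins_in n \<omega> []}"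
    proof (rule compl[OF W_sets])
      have "{\<omega>. edge_label_into \<omega> [] = Safe} - {\<omega>. wins_in n \<omega> []} \<in> sets M"
        using lab_sets sets(1) by (rule sets.Diff)
      then show "{\<omega>. edge_label_into \<omega> [] = Safe \<and> \<not> wins_in n \<omega> []} \<in> sets M"
        by (simp add: set_diff_eq)
      have "\<omega> \<in> - W n \<longleftrightarrow> edge_label_into \<omega> [] = Target \<or>
          edge_label_into \<omega> [] = Safe \<and> \<not> wins_in n \<omega> []" for \<omega>
        by (cases "edge_label_into \<omega> []") (auto simp: W_def)
      then show "- W n = {\<omega>. edge_label_into \<omega> [] = Target} \<union>
          {\<omega>. edge_label_into \<omega> [] = Safe \<and> \<not> wins_in n \<omega> []}"
        by blast
    qed auto
    then show ?thesis
      using v_lab[of n] lab[of Target] pmf_label_pmf[OF p q pq] by simp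
  qed
  show "v (Suc n) = g (l n)"
    using v_Suc[of UNIV n] by (simp add: v_def g_def N[symmetric])
  show "l (Suc n) = g (v n)"
    using l_Suc[of UNIV n] by (simp add: l_def g_def W[symmetric])
qed

theorem theorem1p4:
  fixes lam p q :: real
  assumes "lam > 0"
    and "p \<in> {0..1}" and "q \<in> {0..1}"
    and "0 < p + q" and "p + q < 1"
  defines "M \<equiv> labeled_GW (poisson_pmf lam) p q"
  shows "measure M {\<omega> \<in> space M. game_drawn \<omega>} = 0
           \<longleftrightarrow> (1 - p - q) * lam * exp (- lam * q) \<le> exp 1"
proof -
  interpret M: prob_space M
    unfolding M_def labeled_GW_def by (intro prob_space_PiM measure_pmf.prob_space_axioms)
  have spM: "space M = UNIV"
    unfolding M_def by (rule space_labeled_GW)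
  have sets: "{\<omega>. wins_in n \<omega> []} \<in> sets M" "{\<omega>. loses_in n \<omega> []} \<in> sets M" for n
    using pred_wins_in_loses_in[where chi = "poisson_pmf lam" and p = p and q = q and n = n and v = "[]"] spM by (auto simp: pred_def M_def)
  \<comment> \<open>\<open>V n\<close> decreases and \<open>K n\<close> increases; the draws are
    what lies between their limits.\<close>
  define V where "V n = space M - {\<omega>. wins_in n \<omega> []}" for n
  define K where "K n = {\<omega>. loses_in n \<omega> []}" for n
  define v where "v n = measure M {\<omega>. \<not> wins_in n \<omega> []}" for n
  define l where "l n = measure M {\<omega>. loses_in n \<omega> []}" for n
  have V_sets: "V n \<in> sets M" and K_sets: "K n \<in> sets M" for n
    unfolding V_def K_def using sets by auto
  have v: "v n = measure M (V n)" for n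
    unfolding v_def V_def spM by (rule arg_cong[of _ _ "measure M"]) auto
  have l: "l n = measure M (K n)" for n
    by (simp add: l_def K_def)
  have "decseq V"
    unfolding V_def by (intro decseq_SucI) (use wins_in_loses_in_Suc in blast)
  then have v_lim: "v \<longlonglongrightarrow> measure M (\<Inter>n. V n)"
    unfolding v[abs_def] using V_sets by (intro M.finite_Lim_measure_decseq) auto
  have "incseq K"
    unfolding K_def by (intro incseq_SucI) (use wins_in_loses_in_Suc in blast)
  then have l_lim: "l \<longlonglongrightarrow> measure M (\<Union>n. K n)"
    unfolding l[abs_def] using K_sets by (intro M.finite_Lim_measure_incseq) auto
  \<comment> \<open>No root is both losing and winning, so the probability of the difference is the
    difference of the two limits.\<close>
  have "(\<Union>n. K n) \<subseteq> (\<Inter>n. V n)"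
    using not_wins_and_loses by (auto simp: K_def V_def spM wins_def loses_def)
  moreover have "{\<omega> \<in> space M. game_drawn \<omega>} = (\<Inter>n. V n) - (\<Union>n. K n)"
    by (auto simp: K_def V_def spM game_drawn_def game_won_iff game_lost_iff wins_def loses_def)
  ultimately have "measure M {\<omega> \<in> space M. game_drawn \<omega>} = measure M (\<Inter>n. V n) - measure M (\<Union>n. K n)"
    using V_sets K_sets by (simp add: M.finite_measure_Diff)
  moreover have "measure M (\<Inter>n. V n) = measure M (\<Union>n. K n) \<longleftrightarrow>
      (1 - p - q) * lam * exp (- lam * q) \<le> exp 1"
  proof (rule two_step_iteration_limit[OF _ _ _ _ _ _ _ _ v_lim l_lim])
    show "v 0 = 1" "l 0 = 0"
      using M.prob_space spM by (simp_all add: v_def l_def)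
    show "l n \<le> l (Suc n)" for n
      unfolding l using \<open>incseq K\<close> K_sets by (intro M.finite_measure_mono) (auto simp: incseq_Suc_iff)
    show "v (Suc n) = exp (- lam * (q + (1 - p - q) * l n))"
      "l (Suc n) = exp (- lam * (q + (1 - p - q) * v n))" for n
      using measure_wins_in_loses_in[of lam p q n] assms by (simp_all add: v_def l_def M_def)
  qed (use assms in auto)
  ultimately show ?thesis
    by simp
qed

end
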